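(* Consider the linear minimization oracle $O(\Lambda)\coloneqq\arg\min_{\Sigma}\{\langle\Lambda,\Sigma\rangle:\Sigma\in\mathbb{B}\}$ for a given $\widehat\Sigma$, where the distance function is the Frobenius norm, i.e. $\mathbb{B}\coloneqq\{\Sigma\succeq0:\|\Sigma-\widehat\Sigma\|_F\le\varepsilon\}$. (i) (Closed-form description) For any symmetric matrix $\Lambda$ and a positive scalar $\gamma$, define $$\Sigma^\star(\Lambda,\gamma)\coloneqq\Pi_{\succeq0}\Big[\widehat\Sigma-\frac{1}{2\gamma}\Lambda\Big],$$ where $\Pi_{\succeq0}$ denotes the projection with respect to the Frobenius norm onto the cone of positive semidefinite matrices. Then $O(\Lambda)$ equates to $\Sigma^\star(\Lambda,\gamma^\star)$, where $\gamma^\star$ is the scalar solution to $$\max_{0<\gamma\le\frac1\varepsilon\|\Lambda\|_F}\ \langle\Lambda,\Sigma^\star(\Lambda,\gamma)\rangle+\gamma\big(\|\Sigma^\star(\Lambda,\gamma)-\widehat\Sigma\|_F^2-\varepsilon^2\big).$$ (ii) (Lipschitz constant) The Lipschitz constant $\mathcal{L}\coloneqq\max_{\Sigma\in\mathbb{B}}\|\Sigma\|_F$ (with respect to $\|\cdot\|_F$) of the dual function $g(\Lambda)\coloneqq\min_{\Sigma\in\mathbb{B}}\langle\Lambda,\Sigma\rangle$ is bounded by $$\mathcal{L}\le\varepsilon+\|\widehat\Sigma\|_F .$$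
   Context: All matrices are real symmetric $n\times n$. $\widehat\Sigma$ is a given empirical covariance matrix (hence positive semidefinite) and $\varepsilon$ is the radius of the ball $\mathbb{B}$. $\langle A,B\rangle=\operatorname{Tr}(A^\top B)$ and $\|\cdot\|_F$ is the Frobenius norm. If the oracle problem has several optimizers, $O(\Lambda)$ denotes an arbitrary selection among them.
   Formalization: The scalar maximum need not be attained (e.g. Λ = 0, or Λ = I with Σ̂ = 0), so the closed form is stated for every maximizer γ* that exists; existence is asserted when no minimizer of ⟨Λ,·⟩ over the whole PSD cone lies in the ball. The radius ε is taken positive. *)

theory Defs
  imports "HOL-Analysis.Analysis"
begin

definition symmetric_matrices :: "(real^'n^'n) set" where
  "symmetric_matrices = {A. transpose A = A}"

definition psd_cone :: "(real^'n^'n) set" where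
  "psd_cone = {A \<in> symmetric_matrices. \<forall>x. 0 \<le> x \<bullet> (A *v x)}"

definition frob_inner :: "real^'n^'n \<Rightarrow> real^'n^'n \<Rightarrow> real" where
  "frob_inner A B = trace (transpose A ** B)"

lemma frob_inner_eq_inner: "frob_inner A B = A \<bullet> B"
proof -
  have "frob_inner A B = (\<Sum>i\<in>UNIV. \<Sum>k\<in>UNIV. A $ k $ i * B $ k $ i)"
    by (simp add: frob_inner_def trace_def transpose_def matrix_matrix_mult_def)
  also have "\<dots> = A \<bullet> B"
    by (subst sum.swap) (simp add: inner_vec_def)
  finally show ?thesis .
qed

text \<open>The norm of the type of square matrices is the Frobenius norm, so \<open>dist\<close> and
  \<open>closest_point\<close> below refer to the Frobenius norm as well.\<close>

lemma norm_eq_frobenius: "norm A = sqrt (frob_inner A A)"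
  by (simp add: frob_inner_eq_inner norm_eq_sqrt_inner)

definition frob_ball :: "real^'n^'n \<Rightarrow> real \<Rightarrow> (real^'n^'n) set" where
  "frob_ball \<Sigma>h \<epsilon> = {\<Sigma> \<in> psd_cone. norm (\<Sigma> - \<Sigma>h) \<le> \<epsilon>}"

text \<open>The linear minimization problem as the set of all its optimizers; a selection is any function
  picking an element of this set.\<close>

definition lmo :: "real^'n^'n \<Rightarrow> real \<Rightarrow> real^'n^'n \<Rightarrow> (real^'n^'n) set" where
  "lmo \<Sigma>h \<epsilon> \<Lambda> = {\<Sigma>. is_arg_min (frob_inner \<Lambda>) (\<lambda>S. S \<in> frob_ball \<Sigma>h \<epsilon>) \<Sigma>}"

definition Sigma_star :: "real^'n^'n \<Rightarrow> real^'n^'n \<Rightarrow> real \<Rightarrow> real^'n^'n" where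
  "Sigma_star \<Sigma>h \<Lambda> \<gamma> = closest_point psd_cone (\<Sigma>h - (1 / (2 * \<gamma>)) *\<^sub>R \<Lambda>)"

definition scalar_objective :: "real^'n^'n \<Rightarrow> real \<Rightarrow> real^'n^'n \<Rightarrow> real \<Rightarrow> real" where
  "scalar_objective \<Sigma>h \<epsilon> \<Lambda> \<gamma> =
     frob_inner \<Lambda> (Sigma_star \<Sigma>h \<Lambda> \<gamma>)
       + \<gamma> * ((norm (Sigma_star \<Sigma>h \<Lambda> \<gamma> - \<Sigma>h))\<^sup>2 - \<epsilon>\<^sup>2)"

text \<open>A maximizer need not be unique, and it need not exist: for \<open>\<Lambda> = 0\<close> the interval is
  empty, and for \<open>\<Lambda> = mat 1\<close>, \<open>\<Sigma>h = 0\<close> the objective is \<open>- \<gamma> * \<epsilon>\<^sup>2\<close>. Both failures of existence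
  occur when the norm constraint is redundant, i.e. when a minimizer of \<open>frob_inner \<Lambda>\<close> over the
  whole cone already lies in the ball.\<close>

definition scalar_solution :: "real^'n^'n \<Rightarrow> real \<Rightarrow> real^'n^'n \<Rightarrow> real \<Rightarrow> bool" where
  "scalar_solution \<Sigma>h \<epsilon> \<Lambda> \<gamma>s \<longleftrightarrow>
     is_arg_max (scalar_objective \<Sigma>h \<epsilon> \<Lambda>) (\<lambda>\<gamma>. 0 < \<gamma> \<and> \<gamma> \<le> (1 / \<epsilon>) * norm \<Lambda>) \<gamma>s"

definition dual_fun :: "real^'n^'n \<Rightarrow> real \<Rightarrow> real^'n^'n \<Rightarrow> real" where
  "dual_fun \<Sigma>h \<epsilon> \<Lambda> = (INF \<Sigma>\<in>frob_ball \<Sigma>h \<epsilon>. frob_inner \<Lambda> \<Sigma>)"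

definition lip_const :: "real^'n^'n \<Rightarrow> real \<Rightarrow> real" where
  "lip_const \<Sigma>h \<epsilon> = (SUP \<Sigma>\<in>frob_ball \<Sigma>h \<epsilon>. norm \<Sigma>)"

end

theory Submission
  imports Defs
begin

text \<open>
  The scalar dual rests on the geometry of a closed convex set containing the centre of the ball.
  The argument is carried out for a closed convex set \<open>K\<close> in a Euclidean space, a centre
  \<open>a \<in> K\<close>, a radius \<open>e > 0\<close> and a cost vector \<open>l\<close>, and is then applied to the positive
  semidefinite cone and \<open>\<Sigma>h\<close>.

  Putting a multiplier \<open>\<gamma> > 0\<close> on the constraint \<open>(norm (x - a))\<^sup>2 \<le> e\<^sup>2\<close> and completing the square
  shows that the Lagrangian \<open>l \<bullet> x + \<gamma> * ((norm (x - a))\<^sup>2 - e\<^sup>2)\<close> is minimized over \<open>K\<close> exactly by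
  the projection \<open>p \<gamma>\<close> of \<open>a - l / (2\<gamma>)\<close>, with quadratic growth away from it
  (\<open>lagrangian_growth\<close>). The scalar objective \<open>q \<gamma>\<close> is thus an infimum of functions affine in
  \<open>\<gamma>\<close>, and \<open>h \<gamma> = (norm (p \<gamma> - a))\<^sup>2 - e\<^sup>2\<close> is a supergradient of it
  (\<open>excess_supergradient\<close>).

  At a maximizer of \<open>q\<close> on the interval \<open>0 < \<gamma> \<le> norm l / e\<close> one has \<open>h = 0\<close>: projections are
  nonexpansive, so at the right endpoint \<open>norm (p \<gamma> - a) \<le> e / 2\<close> and \<open>h < 0\<close>; hence the endpoint
  cannot be a maximizer, and at an interior maximizer the supergradients on both sides and the
  continuity of \<open>h\<close> force \<open>h = 0\<close> (\<open>excess_zero_at_maximizer\<close>). Complementary slackness then holds,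
  and by the quadratic growth \<open>p \<gamma>\<close> is the only minimizer over the ball
  (\<open>unique_minimizer_of_excess_zero\<close>).

  Conversely, if \<open>h\<close> has a nonnegative value, then it has a zero by the intermediate value
  theorem, and a zero of \<open>h\<close> maximizes \<open>q\<close>. If \<open>h\<close> is negative throughout, then all \<open>p \<gamma>\<close> lie in
  the ball, and a limit point as \<open>\<gamma>\<close> tends to \<open>0\<close> minimizes \<open>l\<close> over all of \<open>K\<close>, so that the norm
  constraint was redundant (\<open>maximizer_exists\<close>).

  For the Lipschitz constant, \<open>g\<close> is an infimum of linear functionals whose gradients range over
  the ball, so the largest norm in the ball is a Lipschitz constant. It is the best one: if \<open>M\<close> has
  the largest norm, then \<open>g (- M) = - (norm M)\<^sup>2\<close> by the Cauchy--Schwarz inequality while \<open>g 0 = 0\<close>.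
\<close>

section \<open>Linear minimization over a ball intersected with a closed convex set\<close>

locale convex_ball =
  fixes K :: "'a::euclidean_space set" and a :: 'a and e :: real
  assumes closed_K: "closed K" and convex_K: "convex K"
    and center_in: "a \<in> K" and radius_pos: "e > 0"
begin

definition feasible :: "'a set" where
  "feasible = {x \<in> K. norm (x - a) \<le> e}"

definition lagrangian :: "'a \<Rightarrow> real \<Rightarrow> 'a \<Rightarrow> real" where
  "lagrangian l \<gamma> x = l \<bullet> x + \<gamma> * ((norm (x - a))\<^sup>2 - e\<^sup>2)"

definition proj :: "'a \<Rightarrow> real \<Rightarrow> 'a" where
  "proj l \<gamma> = closest_point K (a - (1 / (2 * \<gamma>)) *\<^sub>R l)"

definition excess :: "'a \<Rightarrow> real \<Rightarrow> real" where
  "excess l \<gamma> = (norm (proj l \<gamma> - a))\<^sup>2 - e\<^sup>2"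

definition dual_objective :: "'a \<Rightarrow> real \<Rightarrow> real" where
  "dual_objective l \<gamma> = lagrangian l \<gamma> (proj l \<gamma>)"

lemma compact_feasible: "compact feasible"
proof -
  have "feasible = cball a e \<inter> K"
    by (auto simp: feasible_def dist_norm norm_minus_commute)
  then show ?thesis
    using closed_K by (simp add: compact_Int_closed)
qed

lemma center_feasible: "a \<in> feasible"
  using center_in radius_pos by (simp add: feasible_def)

lemma proj_in: "proj l \<gamma> \<in> K"
  unfolding proj_def using closest_point_in_set[OF closed_K] center_in by blast

text \<open>Completing the square turns the Lagrangian into \<open>\<gamma>\<close> times the squared distance to
  \<open>a - l / (2\<gamma>)\<close>, up to a constant. The growth term is what the obtuse-angle characterization of the
  projection leaves over; it makes the minimizer unique.\<close>

lemma lagrangian_growth: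
  assumes "\<gamma> > 0" "x \<in> K"
  shows "lagrangian l \<gamma> (proj l \<gamma>) + \<gamma> * (norm (x - proj l \<gamma>))\<^sup>2 \<le> lagrangian l \<gamma> x"
proof -
  define p where "p = proj l \<gamma>"
  define z where "z = a - (1 / (2 * \<gamma>)) *\<^sub>R l"
  have obtuse: "(z - p) \<bullet> (x - p) \<le> 0"
    using closest_point_dot[OF convex_K closed_K assms(2)] unfolding p_def z_def proj_def .
  have l: "l = (2 * \<gamma>) *\<^sub>R (a - z)"
    using assms(1) by (simp add: z_def)
  have "lagrangian l \<gamma> x - lagrangian l \<gamma> p - \<gamma> * (norm (x - p))\<^sup>2
      = - (2 * \<gamma>) * ((z - p) \<bullet> (x - p))"
    unfolding lagrangian_def l power2_norm_eq_inner
    by (simp add: inner_diff inner_commute algebra_simps)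
  also have "\<dots> \<ge> 0"
    using obtuse assms(1) by (simp add: mult_le_0_iff)
  finally show ?thesis
    by (simp add: p_def)
qed

lemma dual_objective_le_lagrangian:
  assumes "\<gamma> > 0" "x \<in> K"
  shows "dual_objective l \<gamma> \<le> lagrangian l \<gamma> x"
proof -
  have "0 \<le> \<gamma> * (norm (x - proj l \<gamma>))\<^sup>2"
    using assms(1) by simp
  then show ?thesis
    using lagrangian_growth[OF assms, of l] by (simp add: dual_objective_def)
qed

text \<open>For fixed \<open>x\<close> the Lagrangian is affine in \<open>\<gamma>\<close> with slope \<open>(norm (x - a))\<^sup>2 - e\<^sup>2\<close>; taking
  \<open>x = proj l \<gamma>\<close> as a competitor at \<open>\<gamma>'\<close> gives the supergradient inequality.\<close>

lemma excess_supergradient: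
  assumes "\<gamma>' > 0"
  shows "dual_objective l \<gamma>' \<le> dual_objective l \<gamma> + (\<gamma>' - \<gamma>) * excess l \<gamma>"
  using dual_objective_le_lagrangian[OF assms proj_in, of l l \<gamma>]
  by (simp add: dual_objective_def lagrangian_def excess_def algebra_simps)

lemma continuous_on_excess:
  assumes "S \<subseteq> {0<..}"
  shows "continuous_on S (excess l)"
proof -
  have "continuous_on UNIV (closest_point K)"
    using continuous_on_closest_point[OF convex_K closed_K] center_in by blast
  moreover have "continuous_on S (\<lambda>\<gamma>. a - (1 / (2 * \<gamma>)) *\<^sub>R l)"
    using assms by (intro continuous_intros) auto
  ultimately have "continuous_on S (\<lambda>\<gamma>. closest_point K (a - (1 / (2 * \<gamma>)) *\<^sub>R l))"
    by (rule continuous_on_compose2) auto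
  then show ?thesis
    unfolding excess_def proj_def by (intro continuous_intros)
qed

text \<open>The centre is its own projection, so nonexpansiveness bounds \<open>norm (proj l \<gamma> - a)\<close> by
  \<open>norm l / (2\<gamma>)\<close>, which at the endpoint is half the radius.\<close>

lemma excess_endpoint_neg:
  assumes "l \<noteq> 0"
  shows "excess l (norm l / e) < 0"
proof -
  have "K \<noteq> {}"
    using center_in by blast
  then have "norm (proj l (norm l / e) - a) \<le> norm ((1 / (2 * (norm l / e))) *\<^sub>R l)"
    using closest_point_lipschitz[OF convex_K closed_K, of "a - (1 / (2 * (norm l / e))) *\<^sub>R l" a]
      closest_point_self[OF center_in]
    by (auto simp: proj_def dist_norm)
  also have "\<dots> = e / 2"
    using assms radius_pos by simp
  also have "\<dots> < e"
    using radius_pos by simp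
  finally show ?thesis
    using radius_pos by (simp add: excess_def power_strict_mono)
qed

text \<open>Comparing a maximizer with a point \<open>\<gamma>\<close> to its left (right) through the supergradient at
  \<open>\<gamma>\<close> shows that the excess is nonnegative (nonpositive) there, so by continuity it has
  the same sign at the maximizer itself. The bound from the left also rules out the right endpoint,
  where the excess is negative, so there is room for the comparison from the right.\<close>

lemma excess_zero_at_maximizer:
  assumes max: "is_arg_max (dual_objective l) (\<lambda>\<gamma>. 0 < \<gamma> \<and> \<gamma> \<le> (1 / e) * norm l) \<gamma>s"
  shows "excess l \<gamma>s = 0"
proof -
  define B where "B = norm l / e"
  have \<gamma>s: "0 < \<gamma>s" "\<gamma>s \<le> B"
    using max by (auto simp: is_arg_max_def B_def)
  have le_max: "dual_objective l \<gamma> \<le> dual_objective l \<gamma>s" if "0 < \<gamma>" "\<gamma> \<le> B" for \<gamma>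
    using max that by (auto simp: is_arg_max_def B_def not_less)
  have "l \<noteq> 0"
    using \<gamma>s by (auto simp: B_def)
  have sign: "0 \<le> (\<gamma>s - \<gamma>) * excess l \<gamma>" if "0 < \<gamma>" "\<gamma> \<le> B" for \<gamma>
    using excess_supergradient[OF \<gamma>s(1), of l \<gamma>] le_max[OF that] by linarith
  have lim: "(excess l \<longlongrightarrow> excess l \<gamma>s) (at \<gamma>s)"
    using continuous_on_excess[of "{0<..}" l] \<gamma>s(1)
    by (simp add: continuous_on_eq_continuous_at isCont_def)
  have ge: "0 \<le> excess l \<gamma>s"
  proof (rule tendsto_lowerbound)
    show "(excess l \<longlongrightarrow> excess l \<gamma>s) (at_left \<gamma>s)"
      using lim by (rule tendsto_within_subset) simp
    have "\<forall>\<^sub>F \<gamma> in at_left \<gamma>s. \<gamma> \<in> {0<..<\<gamma>s}"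
      using \<gamma>s(1) by (intro eventually_at_leftI[of 0]) auto
    then show "\<forall>\<^sub>F \<gamma> in at_left \<gamma>s. 0 \<le> excess l \<gamma>"
    proof eventually_elim
      case (elim \<gamma>)
      then show ?case
        using sign[of \<gamma>] \<gamma>s(2) by (simp add: zero_le_mult_iff)
    qed
  qed simp
  have "\<gamma>s < B"
    using ge excess_endpoint_neg[OF \<open>l \<noteq> 0\<close>] \<gamma>s(2) by (cases "\<gamma>s = B") (auto simp: B_def)
  have "excess l \<gamma>s \<le> 0"
  proof (rule tendsto_upperbound)
    show "(excess l \<longlongrightarrow> excess l \<gamma>s) (at_right \<gamma>s)"
      using lim by (rule tendsto_within_subset) simp
    have "\<forall>\<^sub>F \<gamma> in at_right \<gamma>s. \<gamma> \<in> {\<gamma>s<..<B}"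
      using \<open>\<gamma>s < B\<close> by (intro eventually_at_rightI[of _ B]) auto
    then show "\<forall>\<^sub>F \<gamma> in at_right \<gamma>s. excess l \<gamma> \<le> 0"
    proof eventually_elim
      case (elim \<gamma>)
      then show ?case
        using sign[of \<gamma>] \<gamma>s(1) by (simp add: zero_le_mult_iff)
    qed
  qed simp
  with ge show ?thesis
    by simp
qed

text \<open>When the norm constraint is active at the Lagrangian minimizer, the Lagrangian equals the
  linear cost there and bounds it from below on the ball.\<close>

lemma unique_minimizer_of_excess_zero:
  assumes "\<gamma> > 0" "excess l \<gamma> = 0"
  shows "{x. is_arg_min ((\<bullet>) l) (\<lambda>x. x \<in> feasible) x} = {proj l \<gamma>}"
proof -
  define p where "p = proj l \<gamma>"
  have "(norm (p - a))\<^sup>2 = e\<^sup>2"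
    using assms(2) by (simp add: excess_def p_def)
  then have p: "p \<in> feasible" and cost_p: "lagrangian l \<gamma> p = l \<bullet> p"
    using proj_in radius_pos by (auto simp: feasible_def lagrangian_def p_def power2_eq_iff_nonneg)
  have growth: "l \<bullet> p + \<gamma> * (norm (x - p))\<^sup>2 \<le> l \<bullet> x" if "x \<in> feasible" for x
  proof -
    have "(norm (x - a))\<^sup>2 \<le> e\<^sup>2"
      using that by (intro power_mono) (auto simp: feasible_def)
    then have "lagrangian l \<gamma> x \<le> l \<bullet> x"
      using assms(1) by (simp add: lagrangian_def mult_le_0_iff)
    moreover have "x \<in> K"
      using that by (simp add: feasible_def)
    ultimately show ?thesis
      using lagrangian_growth[OF assms(1), of x l] cost_p by (simp add: p_def)
  qed
  have "is_arg_min ((\<bullet>) l) (\<lambda>x. x \<in> feasible) p"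
  proof -
    have "l \<bullet> p \<le> l \<bullet> x" if "x \<in> feasible" for x
    proof -
      have "0 \<le> \<gamma> * (norm (x - p))\<^sup>2"
        using assms(1) by simp
      then show ?thesis
        using growth[OF that] by linarith
    qed
    then show ?thesis
      using p by (auto simp: is_arg_min_def not_less)
  qed
  moreover have "x = p" if "is_arg_min ((\<bullet>) l) (\<lambda>x. x \<in> feasible) x" for x
  proof -
    have "x \<in> feasible" "l \<bullet> x \<le> l \<bullet> p"
      using that p by (auto simp: is_arg_min_def not_less)
    then have "\<gamma> * (norm (x - p))\<^sup>2 \<le> 0"
      using growth[of x] by linarith
    then show ?thesis
      using assms(1) by (simp add: mult_le_0_iff)
  qed
  ultimately show ?thesis
    unfolding p_def by blast
qed

text \<open>Along multipliers tending to \<open>0\<close> the penalty vanishes from the Lagrangian inequality, since the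
  excess stays bounded on the ball, and compactness provides the limit.\<close>

lemma redundant_constraint_of_excess_neg:
  assumes "B > 0" and neg: "\<And>\<gamma>. 0 < \<gamma> \<Longrightarrow> \<gamma> \<le> B \<Longrightarrow> excess l \<gamma> < 0"
  shows "\<exists>x\<in>feasible. is_arg_min ((\<bullet>) l) (\<lambda>y. y \<in> K) x"
proof -
  define \<gamma> where "\<gamma> = (\<lambda>n. B / real (Suc n))"
  have \<gamma>: "0 < \<gamma> n" "\<gamma> n \<le> B" for n
    using assms(1) by (auto simp: \<gamma>_def divide_simps)
  have "\<gamma> \<longlonglongrightarrow> 0"
    unfolding \<gamma>_def
    using tendsto_mult_right_zero[OF LIMSEQ_inverse_real_of_nat, of B] by (simp add: divide_inverse)
  have in_feasible: "proj l (\<gamma> n) \<in> feasible" for n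
  proof -
    have "(norm (proj l (\<gamma> n) - a))\<^sup>2 \<le> e\<^sup>2"
      using neg[OF \<gamma>, of n] by (simp add: excess_def)
    then have "norm (proj l (\<gamma> n) - a) \<le> e"
      by (rule power2_le_imp_le) (use radius_pos in simp)
    then show ?thesis
      by (simp add: feasible_def proj_in)
  qed
  obtain x r where x: "x \<in> feasible" and r: "strict_mono (r :: nat \<Rightarrow> nat)"
    and lim: "((\<lambda>n. proj l (\<gamma> n)) \<circ> r) \<longlonglongrightarrow> x"
  proof (rule seq_compactE)
    show "seq_compact feasible"
      using compact_feasible by (simp add: compact_eq_seq_compact_metric)
    show "\<forall>n. proj l (\<gamma> n) \<in> feasible"
      using in_feasible by blast
  qed
  have lim_proj: "(\<lambda>n. proj l (\<gamma> (r n))) \<longlonglongrightarrow> x"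
    using lim by (simp add: o_def)
  have lim_\<gamma>: "(\<lambda>n. \<gamma> (r n)) \<longlonglongrightarrow> 0"
    using LIMSEQ_subseq_LIMSEQ[OF \<open>\<gamma> \<longlonglongrightarrow> 0\<close> r] by (simp add: o_def)
  have "l \<bullet> x \<le> l \<bullet> y" if "y \<in> K" for y
  proof (rule LIMSEQ_le)
    have "(\<lambda>n. lagrangian l (\<gamma> (r n)) (proj l (\<gamma> (r n))))
        \<longlonglongrightarrow> l \<bullet> x + 0 * ((norm (x - a))\<^sup>2 - e\<^sup>2)"
      unfolding lagrangian_def by (intro tendsto_intros lim_proj lim_\<gamma>)
    then show "(\<lambda>n. dual_objective l (\<gamma> (r n))) \<longlonglongrightarrow> l \<bullet> x"
      by (simp add: dual_objective_def)
    have "(\<lambda>n. lagrangian l (\<gamma> (r n)) y) \<longlonglongrightarrow> l \<bullet> y + 0 * ((norm (y - a))\<^sup>2 - e\<^sup>2)"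
      unfolding lagrangian_def by (intro tendsto_intros lim_\<gamma>)
    then show "(\<lambda>n. lagrangian l (\<gamma> (r n)) y) \<longlonglongrightarrow> l \<bullet> y"
      by simp
    show "\<exists>N. \<forall>n\<ge>N. dual_objective l (\<gamma> (r n)) \<le> lagrangian l (\<gamma> (r n)) y"
      using dual_objective_le_lagrangian[OF \<gamma>(1) that] by blast
  qed
  then have "is_arg_min ((\<bullet>) l) (\<lambda>y. y \<in> K) x"
    using x by (auto simp: is_arg_min_def feasible_def not_less)
  with x show ?thesis
    by blast
qed

lemma maximizer_exists:
  assumes "\<not> (\<exists>x\<in>feasible. is_arg_min ((\<bullet>) l) (\<lambda>y. y \<in> K) x)"
  shows "\<exists>\<gamma>s. is_arg_max (dual_objective l) (\<lambda>\<gamma>. 0 < \<gamma> \<and> \<gamma> \<le> (1 / e) * norm l) \<gamma>s"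
proof -
  define B where "B = norm l / e"
  \<comment> \<open>A zero cost is minimized over \<open>K\<close> by the centre.\<close>
  have "l \<noteq> 0"
    using assms center_feasible center_in by (auto simp: is_arg_min_def)
  then have "B > 0"
    using radius_pos by (simp add: B_def)
  then obtain \<gamma>0 where \<gamma>0: "0 < \<gamma>0" "\<gamma>0 \<le> B" "0 \<le> excess l \<gamma>0"
    using redundant_constraint_of_excess_neg[of B l] assms by (meson not_less)
  have "\<exists>\<gamma>s\<ge>\<gamma>0. \<gamma>s \<le> B \<and> excess l \<gamma>s = 0"
    using \<gamma>0 excess_endpoint_neg[OF \<open>l \<noteq> 0\<close>]
    by (intro IVT2' continuous_on_excess) (auto simp: B_def)
  then obtain \<gamma>s where \<gamma>s: "\<gamma>0 \<le> \<gamma>s" "\<gamma>s \<le> B" "excess l \<gamma>s = 0"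
    by blast
  have "dual_objective l \<gamma> \<le> dual_objective l \<gamma>s" if "0 < \<gamma>" for \<gamma>
    using excess_supergradient[OF that, of l \<gamma>s] \<gamma>s(3) by simp
  then show ?thesis
    using \<gamma>s \<gamma>0 by (intro exI[of _ \<gamma>s]) (auto simp: is_arg_max_linorder B_def)
qed

end

section \<open>Support functions of compact sets\<close>

lemma linear_minimizer_exists:
  fixes F :: "'a::euclidean_space set"
  assumes "compact F" "F \<noteq> {}"
  shows "\<exists>x. is_arg_min ((\<bullet>) l) (\<lambda>y. y \<in> F) x"
proof -
  obtain x where "x \<in> F" "\<forall>y\<in>F. l \<bullet> x \<le> l \<bullet> y"
    using continuous_attains_inf[OF assms continuous_on_inner[OF continuous_on_const continuous_on_id],
      of l] by metis
  then show ?thesis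
    by (auto simp: is_arg_min_def not_less)
qed

lemma INF_eq_of_is_arg_min:
  fixes f :: "'a \<Rightarrow> real"
  assumes "is_arg_min f (\<lambda>y. y \<in> F) x"
  shows "(INF y\<in>F. f y) = f x"
  using assms by (intro cInf_eq_minimum) (auto simp: is_arg_min_def not_less)

lemma norm_maximizer_exists:
  fixes F :: "'a::euclidean_space set"
  assumes "compact F" "F \<noteq> {}"
  shows "\<exists>x. is_arg_max norm (\<lambda>y. y \<in> F) x"
proof -
  obtain x where "x \<in> F" "\<forall>y\<in>F. norm y \<le> norm x"
    using continuous_attains_sup[OF assms continuous_on_norm_id] by metis
  then show ?thesis
    by (auto simp: is_arg_max_def not_less)
qed

text \<open>A minimizer for \<open>m\<close> is a competitor for \<open>l\<close>, which by the Cauchy--Schwarz inequality costs at most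
  \<open>norm (l - m)\<close> times its norm more than the value at \<open>m\<close>; the roles of \<open>l\<close> and \<open>m\<close> are
  symmetric.\<close>

lemma lipschitz_on_INF_inner:
  fixes F :: "'a::euclidean_space set"
  assumes F: "compact F" "F \<noteq> {}" and bound: "\<And>x. x \<in> F \<Longrightarrow> norm x \<le> C"
  shows "C-lipschitz_on S (\<lambda>l. INF x\<in>F. l \<bullet> x)"
proof -
  define g where "g = (\<lambda>l. INF x\<in>F. l \<bullet> x)"
  have one_sided: "g l - g m \<le> C * norm (l - m)" for l m
  proof -
    obtain x where x: "is_arg_min ((\<bullet>) l) (\<lambda>y. y \<in> F) x"
      using linear_minimizer_exists[OF F] by blast
    obtain y where y: "is_arg_min ((\<bullet>) m) (\<lambda>y. y \<in> F) y"
      using linear_minimizer_exists[OF F] by blast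
    have "y \<in> F" and "l \<bullet> x \<le> l \<bullet> y"
      using x y by (auto simp: is_arg_min_def not_less)
    then have "g l - g m \<le> (l - m) \<bullet> y"
      unfolding g_def INF_eq_of_is_arg_min[OF x] INF_eq_of_is_arg_min[OF y]
      by (simp add: inner_diff_left)
    also have "\<dots> \<le> norm (l - m) * norm y"
      by (rule norm_cauchy_schwarz)
    also have "\<dots> \<le> norm (l - m) * C"
      using bound[OF \<open>y \<in> F\<close>] by (rule mult_left_mono) simp
    finally show ?thesis
      by (simp add: mult.commute)
  qed
  have "0 \<le> C"
    using F(2) bound norm_ge_zero order_trans by blast
  moreover have "dist (g l) (g m) \<le> C * dist l m" for l m
    using one_sided[of l m] one_sided[of m l] by (simp add: dist_norm norm_minus_commute)
  ultimately show ?thesis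
    unfolding g_def[symmetric] by (intro lipschitz_onI)
qed

text \<open>The Lipschitz inequality between \<open>0\<close> and \<open>- x\<close>, where \<open>x\<close> has the largest norm, is
  \<open>(norm x)\<^sup>2 \<le> C * norm x\<close>.\<close>

lemma norm_le_lipschitz_constant_INF_inner:
  fixes F :: "'a::euclidean_space set"
  assumes lip: "C-lipschitz_on S (\<lambda>l. INF x\<in>F. l \<bullet> x)"
    and max: "is_arg_max norm (\<lambda>y. y \<in> F) x" and S: "0 \<in> S" "- x \<in> S"
  shows "norm x \<le> C"
proof -
  have "x \<in> F" and le: "\<And>y. y \<in> F \<Longrightarrow> norm y \<le> norm x"
    using max by (auto simp: is_arg_max_def not_less)
  have "is_arg_min ((\<bullet>) (- x)) (\<lambda>y. y \<in> F) x"
  proof -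
    have "x \<bullet> y \<le> x \<bullet> x" if "y \<in> F" for y
    proof -
      have "x \<bullet> y \<le> norm x * norm y"
        by (rule norm_cauchy_schwarz)
      also have "\<dots> \<le> norm x * norm x"
        using le[OF that] by (rule mult_left_mono) simp
      finally show ?thesis
        by (simp add: norm_eq_sqrt_inner)
    qed
    then show ?thesis
      using \<open>x \<in> F\<close> by (auto simp: is_arg_min_def not_less)
  qed
  then have "(INF y\<in>F. (- x) \<bullet> y) = (- x) \<bullet> x"
    by (rule INF_eq_of_is_arg_min)
  moreover have "(INF y\<in>F. (0::'a) \<bullet> y) = 0"
    using \<open>x \<in> F\<close> by (auto simp: image_constant_conv)
  ultimately have "norm x * norm x \<le> C * norm x"
    using lipschitz_onD[OF lip S] by (simp add: dist_norm norm_eq_sqrt_inner)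
  moreover have "0 \<le> C"
    using lip by (rule lipschitz_on_nonneg)
  ultimately show ?thesis
    by (cases "x = 0") auto
qed

section \<open>Symmetric and positive semidefinite matrices\<close>

lemma subspace_symmetric_matrices: "subspace (symmetric_matrices :: (real^'n^'n) set)"
  unfolding subspace_def symmetric_matrices_def
  by (auto simp: transpose_def vec_eq_iff)

lemma psd_cone_eq_Inter:
  "(psd_cone :: (real^'n^'n) set) = symmetric_matrices \<inter> (\<Inter>x. {A. 0 \<le> x \<bullet> (A *v x)})"
  by (auto simp: psd_cone_def)

lemma linear_quadratic_form: "linear (\<lambda>A :: real^'n^'n. x \<bullet> (A *v x))"
  by (rule linearI)
    (simp_all add: matrix_vector_mult_add_rdistrib inner_add_right scaleR_matrix_vector_assoc[symmetric])

lemma closed_psd_cone: "closed (psd_cone :: (real^'n^'n) set)"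
proof -
  have "closed {A :: real^'n^'n. 0 \<le> x \<bullet> (A *v x)}" for x
    using linear_quadratic_form[of x] linear_conv_bounded_linear
    by (intro closed_Collect_le continuous_on_const linear_continuous_on) blast
  then show ?thesis
    unfolding psd_cone_eq_Inter
    by (intro closed_Int closed_INT) (simp_all add: closed_subspace subspace_symmetric_matrices)
qed

lemma convex_psd_cone: "convex (psd_cone :: (real^'n^'n) set)"
proof -
  have "convex {A :: real^'n^'n. 0 \<le> x \<bullet> (A *v x)}" for x
  proof -
    have "convex ((\<lambda>A :: real^'n^'n. x \<bullet> (A *v x)) -` {0..})"
      using linear_quadratic_form by (rule convex_linear_vimage) simp
    then show ?thesis
      by (simp add: vimage_def)
  qed
  then show ?thesis
    unfolding psd_cone_eq_Inter
    by (intro convex_Int convex_INT) (simp_all add: subspace_imp_convex subspace_symmetric_matrices)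
qed

section \<open>The linear minimization oracle\<close>

theorem proposition3p1:
  fixes \<Sigma>h :: "real^'n^'n" and \<epsilon> :: real
  assumes "\<Sigma>h \<in> psd_cone" and "\<epsilon> > 0"
  shows
    "(\<forall>\<Lambda>\<in>symmetric_matrices. \<forall>\<gamma>s.
        scalar_solution \<Sigma>h \<epsilon> \<Lambda> \<gamma>s \<longrightarrow> lmo \<Sigma>h \<epsilon> \<Lambda> = {Sigma_star \<Sigma>h \<Lambda> \<gamma>s})
     \<and> (\<forall>\<Lambda>\<in>symmetric_matrices.
        \<not> (\<exists>\<Sigma>\<in>frob_ball \<Sigma>h \<epsilon>. is_arg_min (frob_inner \<Lambda>) (\<lambda>S. S \<in> psd_cone) \<Sigma>) \<longrightarrow>
        (\<exists>\<gamma>s. scalar_solution \<Sigma>h \<epsilon> \<Lambda> \<gamma>s))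
     \<and> (\<forall>\<Lambda>\<in>symmetric_matrices. \<exists>\<Sigma>\<in>lmo \<Sigma>h \<epsilon> \<Lambda>. frob_inner \<Lambda> \<Sigma> = dual_fun \<Sigma>h \<epsilon> \<Lambda>)
     \<and> (\<exists>\<Sigma>. is_arg_max norm (\<lambda>S. S \<in> frob_ball \<Sigma>h \<epsilon>) \<Sigma> \<and> norm \<Sigma> = lip_const \<Sigma>h \<epsilon>)
     \<and> (lip_const \<Sigma>h \<epsilon>)-lipschitz_on symmetric_matrices (dual_fun \<Sigma>h \<epsilon>)
     \<and> (\<forall>C. C-lipschitz_on symmetric_matrices (dual_fun \<Sigma>h \<epsilon>) \<longrightarrow> lip_const \<Sigma>h \<epsilon> \<le> C)
     \<and> lip_const \<Sigma>h \<epsilon> \<le> \<epsilon> + norm \<Sigma>h"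
proof -
  interpret convex_ball psd_cone \<Sigma>h \<epsilon>
    using assms closed_psd_cone convex_psd_cone by unfold_locales
  have inner: "frob_inner \<Lambda> = (\<bullet>) \<Lambda>" for \<Lambda> :: "real^'n^'n"
    by (simp add: fun_eq_iff frob_inner_eq_inner)
  have ball: "frob_ball \<Sigma>h \<epsilon> = feasible"
    by (simp add: frob_ball_def feasible_def)
  have star: "Sigma_star \<Sigma>h \<Lambda> = proj \<Lambda>" for \<Lambda>
    by (simp add: fun_eq_iff Sigma_star_def proj_def)
  have objective: "scalar_objective \<Sigma>h \<epsilon> \<Lambda> = dual_objective \<Lambda>" for \<Lambda>
    by (simp add: fun_eq_iff scalar_objective_def dual_objective_def lagrangian_def star inner)
  have dual: "dual_fun \<Sigma>h \<epsilon> = (\<lambda>\<Lambda>. INF \<Sigma>\<in>feasible. \<Lambda> \<bullet> \<Sigma>)"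
    by (simp add: fun_eq_iff dual_fun_def ball inner)
  have ne: "feasible \<noteq> {}"
    using center_feasible by blast
  obtain M where M: "is_arg_max norm (\<lambda>S. S \<in> feasible) M"
    using norm_maximizer_exists[OF compact_feasible ne] by blast
  then have "M \<in> feasible" and le_M: "\<And>S. S \<in> feasible \<Longrightarrow> norm S \<le> norm M"
    by (auto simp: is_arg_max_def not_less)
  then have lip: "lip_const \<Sigma>h \<epsilon> = norm M"
    unfolding lip_const_def ball by (intro cSup_eq_maximum) auto
  have closed_form: "lmo \<Sigma>h \<epsilon> \<Lambda> = {Sigma_star \<Sigma>h \<Lambda> \<gamma>s}" if "scalar_solution \<Sigma>h \<epsilon> \<Lambda> \<gamma>s" for \<Lambda> \<gamma>s
  proof -
    have max: "is_arg_max (dual_objective \<Lambda>) (\<lambda>\<gamma>. 0 < \<gamma> \<and> \<gamma> \<le> (1 / \<epsilon>) * norm \<Lambda>) \<gamma>s"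
      using that by (simp add: scalar_solution_def objective)
    then have "\<gamma>s > 0"
      by (simp add: is_arg_max_def)
    then show ?thesis
      using unique_minimizer_of_excess_zero excess_zero_at_maximizer[OF max]
      by (simp add: lmo_def inner ball star)
  qed
  have solution: "\<exists>\<gamma>s. scalar_solution \<Sigma>h \<epsilon> \<Lambda> \<gamma>s"
    if "\<not> (\<exists>\<Sigma>\<in>frob_ball \<Sigma>h \<epsilon>. is_arg_min (frob_inner \<Lambda>) (\<lambda>S. S \<in> psd_cone) \<Sigma>)" for \<Lambda>
    using maximizer_exists[of \<Lambda>] that by (simp add: scalar_solution_def objective inner ball)
  have attained: "\<exists>\<Sigma>\<in>lmo \<Sigma>h \<epsilon> \<Lambda>. frob_inner \<Lambda> \<Sigma> = dual_fun \<Sigma>h \<epsilon> \<Lambda>" for \<Lambda>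
  proof -
    obtain \<Sigma> where \<Sigma>: "is_arg_min ((\<bullet>) \<Lambda>) (\<lambda>S. S \<in> feasible) \<Sigma>"
      using linear_minimizer_exists[OF compact_feasible ne] by blast
    then show ?thesis
      using INF_eq_of_is_arg_min[OF \<Sigma>] by (auto simp: lmo_def inner ball dual)
  qed
  have lipschitz: "(lip_const \<Sigma>h \<epsilon>)-lipschitz_on symmetric_matrices (dual_fun \<Sigma>h \<epsilon>)"
    unfolding lip dual using compact_feasible ne le_M by (rule lipschitz_on_INF_inner)
  have optimal: "lip_const \<Sigma>h \<epsilon> \<le> C"
    if "C-lipschitz_on symmetric_matrices (dual_fun \<Sigma>h \<epsilon>)" for C
  proof -
    have "M \<in> psd_cone"
      using \<open>M \<in> feasible\<close> by (simp add: feasible_def)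
    then have "M \<in> symmetric_matrices"
      by (simp add: psd_cone_def)
    then show ?thesis
      using that M norm_le_lipschitz_constant_INF_inner
        subspace_0[OF subspace_symmetric_matrices] subspace_neg[OF subspace_symmetric_matrices]
      unfolding lip dual by blast
  qed
  have "norm M \<le> \<epsilon> + norm \<Sigma>h"
    using \<open>M \<in> feasible\<close> norm_triangle_sub[of M \<Sigma>h] by (simp add: feasible_def)
  then show ?thesis
    using closed_form solution attained lipschitz optimal M lip by (auto simp: ball)
qed

end
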